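(* For each positive integer $k$, $\mathrm{minprol}(k)\geqslant\lceil k^2/2+2k+1\rceil$; that is, if $n>k$ and some $\sigma\in S_n$ is $k$-prolific, then $n\geqslant\lceil k^2/2+2k+1\rceil$.
   Context: $S_n$ is the set of permutations of $[n]$. A permutation $\sigma\in S_n$ contains $\pi\in S_r$ ($\pi\preceq\sigma$) if there are indices $i_1<\dots<i_r$ with $\sigma(i_1)\cdots\sigma(i_r)$ in the same relative order as $\pi$; for $n>k\geqslant1$, $\sigma$ is $k$-prolific if $|\{\pi\in S_{n-k}:\pi\preceq\sigma\}|=\binom{n}{k}$. $\mathrm{minprol}(k)$ is the minimum $n$ for which a $k$-prolific permutation in $S_n$ exists. *)

theory Defs
  imports Complex_Main "HOL-Combinatorics.Permutations" "HOL-Library.Extended_Nat"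
begin

definition contains_pattern :: "nat \<Rightarrow> (nat \<Rightarrow> nat) \<Rightarrow> nat \<Rightarrow> (nat \<Rightarrow> nat) \<Rightarrow> bool" where
  "contains_pattern r \<pi> n \<sigma> \<longleftrightarrow>
     (\<exists>i. i ` {1..r} \<subseteq> {1..n} \<and> strict_mono_on {1..r} i \<and>
        (\<forall>a\<in>{1..r}. \<forall>b\<in>{1..r}. \<pi> a < \<pi> b \<longleftrightarrow> \<sigma> (i a) < \<sigma> (i b)))"

definition prolific :: "nat \<Rightarrow> nat \<Rightarrow> (nat \<Rightarrow> nat) \<Rightarrow> bool" where
  "prolific k n \<sigma> \<longleftrightarrow>
     1 \<le> k \<and> k < n \<and> \<sigma> permutes {1..n} \<and>
     card {\<pi>. \<pi> permutes {1..n - k} \<and> contains_pattern (n - k) \<pi> n \<sigma>} = n choose k"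

text \<open>Valued in \<^typ>\<open>enat\<close> so that the bound does not depend on the existence of prolific
  permutations: the infimum is the minimum of the set if it is nonempty, and infinite otherwise.\<close>

definition minprol :: "nat \<Rightarrow> enat" where
  "minprol k = Inf {enat n | n. \<exists>\<sigma>. prolific k n \<sigma>}"

end

theory Submission
  imports Defs
begin

text \<open>
  Put \<open>d = k + 2\<close>. If two points of the plot of a \<open>k\<close>-prolific permutation were at
  \<open>L\<^sup>1\<close>-distance less than \<open>d\<close>, then, after deleting the at most \<open>k - 1\<close> points lying strictly
  between them horizontally or vertically, deleting either one of the two would give the same
  pattern. So all distances are at least \<open>d\<close>.

  Take the \<open>d\<close> points in \<open>d\<close> consecutive columns with centre \<open>x\<close>. Walking through them from bottom
  to top, consecutive points with columns \<open>c, c'\<close> have heights differing by at least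
  \<open>d - \<bar>c - x\<bar> - \<bar>c' - x\<bar>\<close>; summing up, the \<open>L\<^sup>1\<close>-distances from \<open>(x, n)\<close> and from \<open>(x, 1)\<close> to the
  plot have sum at most about \<open>n + d - d\<^sup>2 / 2\<close>, hence one of the two is at most half of that.
  Since every row contains a single point, only about \<open>t\<^sup>2\<close> centres \<open>x\<close> are such that \<open>(x, n)\<close> is
  within distance \<open>t\<close> of the plot, and likewise for \<open>(x, 1)\<close>. If \<open>n < d\<^sup>2 / 2 - 1\<close>, this leaves
  some of the \<open>n - d + 1\<close> centres uncovered.
\<close>

section \<open>Prolific permutations have large breadth\<close>

text \<open>Fixing the set of positions lets patterns be matched with the
  \<open>(n - k)\<close>-subsets of \<open>{1..n}\<close>, whose number is the binomial coefficient
  in \<open>prolific\<close>.\<close>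

definition occurs_at :: "nat \<Rightarrow> (nat \<Rightarrow> nat) \<Rightarrow> (nat \<Rightarrow> nat) \<Rightarrow> nat set \<Rightarrow> bool" where
  "occurs_at r \<pi> \<sigma> S \<longleftrightarrow>
     (\<exists>e. e ` {1..r} = S \<and> strict_mono_on {1..r} e \<and>
        (\<forall>a\<in>{1..r}. \<forall>b\<in>{1..r}. \<pi> a < \<pi> b \<longleftrightarrow> \<sigma> (e a) < \<sigma> (e b)))"

lemma contains_pattern_imp_occurs_at:
  assumes "contains_pattern r \<pi> n \<sigma>"
  shows "\<exists>S. S \<subseteq> {1..n} \<and> card S = r \<and> occurs_at r \<pi> \<sigma> S"
proof -
  obtain e where e: "e ` {1..r} \<subseteq> {1..n}" "strict_mono_on {1..r} e"
    "\<forall>a\<in>{1..r}. \<forall>b\<in>{1..r}. \<pi> a < \<pi> b \<longleftrightarrow> \<sigma> (e a) < \<sigma> (e b)"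
    using assms unfolding contains_pattern_def by blast
  have "card (e ` {1..r}) = r"
    using card_image[OF strict_mono_on_imp_inj_on[OF e(2)]] by simp
  with e show ?thesis unfolding occurs_at_def by blast
qed

lemma permutes_eq_card_le:
  assumes "\<pi> permutes {1..r}" "a \<in> {1..r}"
  shows "\<pi> a = card {b \<in> {1..r}. \<pi> b \<le> \<pi> a}"
proof -
  have "\<pi> ` {b \<in> {1..r}. \<pi> b \<le> \<pi> a} = {1..\<pi> a}"
  proof (intro equalityI subsetI)
    fix y assume "y \<in> \<pi> ` {b \<in> {1..r}. \<pi> b \<le> \<pi> a}"
    then obtain b where b: "b \<in> {1..r}" "\<pi> b \<le> \<pi> a" "y = \<pi> b" by blast
    have "\<pi> b \<in> {1..r}" using permutes_in_image[OF assms(1)] b(1) by blast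
    then show "y \<in> {1..\<pi> a}" using b by simp
  next
    fix y assume y: "y \<in> {1..\<pi> a}"
    have "\<pi> a \<in> {1..r}" using permutes_in_image[OF assms(1)] assms(2) by blast
    then have "y \<in> \<pi> ` {1..r}" using y permutes_image[OF assms(1)] by simp
    then show "y \<in> \<pi> ` {b \<in> {1..r}. \<pi> b \<le> \<pi> a}" using y by auto
  qed
  moreover have "inj_on \<pi> {b \<in> {1..r}. \<pi> b \<le> \<pi> a}"
    using permutes_inj_on[OF assms(1)] .
  ultimately show ?thesis using card_image by fastforce
qed

lemma strict_mono_on_card_le:
  fixes e :: "nat \<Rightarrow> nat"
  assumes "strict_mono_on {1..r} e" "a \<in> {1..r}"
  shows "card {s \<in> e ` {1..r}. s \<le> e a} = a"
proof -
  have "e b \<le> e a \<longleftrightarrow> b \<le> a" if "b \<in> {1..r}" for b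
    using strict_mono_on_less_eq[OF assms(1) that assms(2)] by simp
  then have "{s \<in> e ` {1..r}. s \<le> e a} = e ` {1..a}" using assms(2) by auto
  moreover have "inj_on e {1..a}"
    by (rule inj_on_subset[OF strict_mono_on_imp_inj_on[OF assms(1)]]) (use assms(2) in auto)
  ultimately show ?thesis by (simp add: card_image)
qed

lemma strict_mono_on_same_image:
  fixes e e' :: "nat \<Rightarrow> nat"
  assumes "strict_mono_on {1..r} e" "strict_mono_on {1..r} e'"
    and "e ` {1..r} = e' ` {1..r}" "a \<in> {1..r}"
  shows "e a = e' a"
proof -
  obtain b where b: "b \<in> {1..r}" "e a = e' b" using assms(3,4) by blast
  have "b = a"
    using strict_mono_on_card_le[OF assms(1,4)] strict_mono_on_card_le[OF assms(2) b(1)] assms(3) b(2)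
    by simp
  then show ?thesis using b(2) by simp
qed

text \<open>\<open>S\<close> has a single increasing enumeration, so it fixes all comparisons
  between pattern values; by \<open>permutes_eq_card_le\<close> these determine the values
  themselves.\<close>

lemma occurs_at_unique:
  assumes "\<pi> permutes {1..r}" "\<pi>' permutes {1..r}"
    and "occurs_at r \<pi> \<sigma> S" "occurs_at r \<pi>' \<sigma> S"
  shows "\<pi> = \<pi>'"
proof
  fix a
  obtain e where e: "e ` {1..r} = S" "strict_mono_on {1..r} e"
    "\<forall>a\<in>{1..r}. \<forall>b\<in>{1..r}. \<pi> a < \<pi> b \<longleftrightarrow> \<sigma> (e a) < \<sigma> (e b)"
    using assms(3) unfolding occurs_at_def by blast
  obtain e' where e': "e' ` {1..r} = S" "strict_mono_on {1..r} e'"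
    "\<forall>a\<in>{1..r}. \<forall>b\<in>{1..r}. \<pi>' a < \<pi>' b \<longleftrightarrow> \<sigma> (e' a) < \<sigma> (e' b)"
    using assms(4) unfolding occurs_at_def by blast
  have same: "e b = e' b" if "b \<in> {1..r}" for b
    using strict_mono_on_same_image[OF e(2) e'(2) _ that] e(1) e'(1) by simp
  show "\<pi> a = \<pi>' a"
  proof (cases "a \<in> {1..r}")
    case True
    have "\<pi> b \<le> \<pi> a \<longleftrightarrow> \<pi>' b \<le> \<pi>' a" if "b \<in> {1..r}" for b
      using e(3) e'(3) True that same by (metis linorder_not_less)
    then have "{b \<in> {1..r}. \<pi> b \<le> \<pi> a} = {b \<in> {1..r}. \<pi>' b \<le> \<pi>' a}" by blast
    then show ?thesis
      using permutes_eq_card_le[OF assms(1) True] permutes_eq_card_le[OF assms(2) True] by simp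
  next
    case False
    then show ?thesis using assms(1,2) by (metis permutes_not_in)
  qed
qed

text \<open>Choosing positions for each pattern is injective, as positions determine the pattern.
  Prolificity makes both sides equally large, so every \<open>(n - k)\<close>-subset is chosen and
  distinct subsets carry distinct patterns.\<close>

lemma prolific_occurs_at_bij:
  assumes "prolific k n \<sigma>"
  obtains h where "bij_betw h {\<pi>. \<pi> permutes {1..n - k} \<and> contains_pattern (n - k) \<pi> n \<sigma>}
      {S. S \<subseteq> {1..n} \<and> card S = n - k}"
    and "\<And>\<pi>. contains_pattern (n - k) \<pi> n \<sigma> \<Longrightarrow> occurs_at (n - k) \<pi> \<sigma> (h \<pi>)"
proof -
  define P where "P = {\<pi>. \<pi> permutes {1..n - k} \<and> contains_pattern (n - k) \<pi> n \<sigma>}"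
  define F where "F = {S. S \<subseteq> {1..n} \<and> card S = n - k}"
  define h where "h \<pi> = (SOME S. S \<subseteq> {1..n} \<and> card S = n - k \<and> occurs_at (n - k) \<pi> \<sigma> S)" for \<pi>
  have h: "h \<pi> \<subseteq> {1..n} \<and> card (h \<pi>) = n - k \<and> occurs_at (n - k) \<pi> \<sigma> (h \<pi>)"
    if "contains_pattern (n - k) \<pi> n \<sigma>" for \<pi>
    unfolding h_def by (rule someI_ex) (rule contains_pattern_imp_occurs_at[OF that])
  have inj: "inj_on h P"
  proof (rule inj_onI)
    fix \<pi> \<pi>' assume "\<pi> \<in> P" "\<pi>' \<in> P" "h \<pi> = h \<pi>'"
    then show "\<pi> = \<pi>'"
      using occurs_at_unique[of \<pi> "n - k" \<pi>' \<sigma> "h \<pi>"] h[of \<pi>] h[of \<pi>'] by (simp add: P_def)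
  qed
  have "k \<le> n" using assms by (simp add: prolific_def)
  then have "card F = card P"
    using assms n_subsets[of "{1..n}" "n - k"]
    by (simp add: F_def P_def prolific_def binomial_symmetric[symmetric])
  moreover have "finite F" by (simp add: F_def)
  moreover have "h ` P \<subseteq> F" using h by (auto simp: P_def F_def)
  ultimately have "h ` P = F"
    using card_subset_eq card_image[OF inj] by metis
  with inj have "bij_betw h P F" by (simp add: bij_betw_def)
  then show thesis using that h by (simp add: P_def F_def)
qed

lemma occurs_at_transfer:
  assumes "occurs_at r \<pi> \<sigma> S" "strict_mono_on S \<tau>" "\<tau> ` S = S'"
    and "\<And>x y. x \<in> S \<Longrightarrow> y \<in> S \<Longrightarrow> \<sigma> x < \<sigma> y \<longleftrightarrow> \<sigma> (\<tau> x) < \<sigma> (\<tau> y)"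
  shows "occurs_at r \<pi> \<sigma> S'"
proof -
  obtain e where e: "e ` {1..r} = S" "strict_mono_on {1..r} e"
    "\<forall>a\<in>{1..r}. \<forall>b\<in>{1..r}. \<pi> a < \<pi> b \<longleftrightarrow> \<sigma> (e a) < \<sigma> (e b)"
    using assms(1) unfolding occurs_at_def by blast
  have mem: "e a \<in> S" if "a \<in> {1..r}" for a using that e(1) by blast
  have "(\<tau> \<circ> e) ` {1..r} = S'" using e(1) assms(3) by (metis image_comp)
  moreover have "strict_mono_on {1..r} (\<tau> \<circ> e)"
    using e(2) assms(2) mem by (auto simp: strict_mono_on_def)
  moreover have "\<forall>a\<in>{1..r}. \<forall>b\<in>{1..r}. \<pi> a < \<pi> b \<longleftrightarrow> \<sigma> ((\<tau> \<circ> e) a) < \<sigma> ((\<tau> \<circ> e) b)"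
    using e(3) assms(4) mem by simp
  ultimately show ?thesis unfolding occurs_at_def by blast
qed

lemma prolific_breadth:
  assumes prol: "prolific k n \<sigma>" and ij: "i \<in> {1..n}" "j \<in> {1..n}" "i < j"
  shows "int k + 2 \<le> \<bar>int i - int j\<bar> + \<bar>int (\<sigma> i) - int (\<sigma> j)\<bar>"
proof (rule ccontr)
  assume close: "\<not> ?thesis"
  have k: "1 \<le> k" "k < n" and perm: "\<sigma> permutes {1..n}"
    using prol by (auto simp: prolific_def)
  have inj: "\<sigma> x = \<sigma> y \<longleftrightarrow> x = y" for x y
    using permutes_inj[OF perm] by (auto dest: injD)
  define V where "V = {x \<in> {1..n}. min (\<sigma> i) (\<sigma> j) < \<sigma> x \<and> \<sigma> x < max (\<sigma> i) (\<sigma> j)}"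
  define B where "B = {i<..<j} \<union> V"
  have "card V \<le> card {min (\<sigma> i) (\<sigma> j)<..<max (\<sigma> i) (\<sigma> j)}"
    by (rule card_inj_on_le[of \<sigma>]) (auto simp: V_def inj_on_def inj)
  moreover have "\<sigma> i \<noteq> \<sigma> j" using ij inj by simp
  ultimately have "int (card V) \<le> \<bar>int (\<sigma> i) - int (\<sigma> j)\<bar> - 1" by (auto simp: min_def max_def split: if_splits)
  moreover have "int (card {i<..<j}) = \<bar>int i - int j\<bar> - 1" using ij by auto
  moreover have "card B \<le> card {i<..<j} + card V" unfolding B_def by (rule card_Un_le)
  ultimately have cardB: "card B \<le> k - 1" using close k by linarith
  have sub: "B \<subseteq> {1..n} - {i, j}" using ij by (auto simp: B_def V_def)
  have "card ({1..n} - {i, j}) = n - 2" using ij by (simp add: card_Diff_subset)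
  then have "k - 1 \<le> card ({1..n} - {i, j})" using k by linarith
  \<comment> \<open>Padding \<open>B\<close> to exactly \<open>k - 1\<close> points makes
    \<open>insert i Q\<close> and \<open>insert j Q\<close> deletions of size
    \<open>k\<close>.\<close>
  then obtain Q where Q: "B \<subseteq> Q" "Q \<subseteq> {1..n} - {i, j}" "card Q = k - 1"
    using exists_subset_between[OF cardB _ sub] by blast
  define S1 where "S1 = {1..n} - insert i Q"
  define S2 where "S2 = {1..n} - insert j Q"
  have finQ: "finite Q" using Q(2) finite_subset by blast
  have "i \<notin> Q" "j \<notin> Q" using Q(2) by auto
  then have cards: "card (insert i Q) = k" "card (insert j Q) = k" using finQ Q(3) k by auto
  have "card S1 = n - k" "card S2 = n - k"
    unfolding S1_def S2_def using cards Q(2) ij finQ by (subst card_Diff_subset; auto)+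
  then have memF: "S1 \<in> {S. S \<subseteq> {1..n} \<and> card S = n - k}" "S2 \<in> {S. S \<subseteq> {1..n} \<and> card S = n - k}"
    by (auto simp: S1_def S2_def)
  obtain h where h: "bij_betw h {\<pi>. \<pi> permutes {1..n - k} \<and> contains_pattern (n - k) \<pi> n \<sigma>}
      {S. S \<subseteq> {1..n} \<and> card S = n - k}"
    "\<And>\<pi>. contains_pattern (n - k) \<pi> n \<sigma> \<Longrightarrow> occurs_at (n - k) \<pi> \<sigma> (h \<pi>)"
    using prolific_occurs_at_bij[OF prol] by blast
  obtain \<pi>1 where \<pi>1: "\<pi>1 permutes {1..n - k}" "contains_pattern (n - k) \<pi>1 n \<sigma>" "h \<pi>1 = S1"
    using memF(1) unfolding bij_betw_imp_surj_on[OF h(1), symmetric] by blast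
  obtain \<pi>2 where \<pi>2: "\<pi>2 permutes {1..n - k}" "contains_pattern (n - k) \<pi>2 n \<sigma>" "h \<pi>2 = S2"
    using memF(2) unfolding bij_betw_imp_surj_on[OF h(1), symmetric] by blast
  \<comment> \<open>Sliding \<open>j\<close> to \<open>i\<close> preserves both orders on
    \<open>S1\<close>, because no point of \<open>S1\<close> lies strictly between the two
    horizontally or vertically.\<close>
  define \<tau> where "\<tau> x = (if x = j then i else x)" for x
  have S1: "x \<in> {1..n}" "x \<noteq> i" "\<not> (i < x \<and> x < j)"
    "\<not> (min (\<sigma> i) (\<sigma> j) < \<sigma> x \<and> \<sigma> x < max (\<sigma> i) (\<sigma> j))" if "x \<in> S1" for x
    using that Q(1) by (auto simp: S1_def B_def V_def)
  have "occurs_at (n - k) \<pi>1 \<sigma> S2"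
  proof (rule occurs_at_transfer)
    show "occurs_at (n - k) \<pi>1 \<sigma> S1" using h(2)[OF \<pi>1(2)] \<pi>1(3) by simp
    show "strict_mono_on S1 \<tau>"
    proof (rule strict_mono_onI)
      fix x y assume "x \<in> S1" "y \<in> S1" "x < y"
      then show "\<tau> x < \<tau> y" using S1[of x] S1[of y] ij(3) by (auto simp: \<tau>_def)
    qed
    show "\<tau> ` S1 = S2"
      using ij \<open>i \<notin> Q\<close> \<open>j \<notin> Q\<close> by (auto simp: \<tau>_def S1_def S2_def image_iff)
    fix x y assume xy: "x \<in> S1" "y \<in> S1"
    have ne: "\<sigma> x \<noteq> \<sigma> i" "\<sigma> y \<noteq> \<sigma> i" using S1(2) xy inj by blast+
    have ne': "x \<noteq> j \<Longrightarrow> \<sigma> x \<noteq> \<sigma> j" "y \<noteq> j \<Longrightarrow> \<sigma> y \<noteq> \<sigma> j" using inj by blast+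
    show "\<sigma> x < \<sigma> y \<longleftrightarrow> \<sigma> (\<tau> x) < \<sigma> (\<tau> y)"
      using S1(4)[OF xy(1)] S1(4)[OF xy(2)] ne ne'
      by (cases "x = j"; cases "y = j") (auto simp: \<tau>_def min_def max_def split: if_splits)
  qed
  then have "\<pi>1 = \<pi>2"
    using occurs_at_unique[OF \<pi>1(1) \<pi>2(1)] h(2)[OF \<pi>2(2)] \<pi>2(3) by simp
  then have "S1 = S2" using \<pi>1(3) \<pi>2(3) by simp
  moreover have "j \<in> S1" "j \<notin> S2" using ij \<open>j \<notin> Q\<close> by (auto simp: S1_def S2_def)
  ultimately show False by blast
qed

section \<open>Consecutive columns\<close>

text \<open>Column offsets are doubled, so that \<open>X\<close> stands for twice the centre of a window and stays
  integral also when the window has an even number of columns.\<close>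

lemma height_range_lower_bound:
  fixes s :: "int \<Rightarrow> int" and d X :: int
  assumes "finite A" "A \<noteq> {}"
    and "\<And>a b. a \<in> A \<Longrightarrow> b \<in> A \<Longrightarrow> a \<noteq> b \<Longrightarrow> d \<le> \<bar>a - b\<bar> + \<bar>s a - s b\<bar>"
  shows "\<exists>p\<in>A. \<exists>q\<in>A. 2 * (s q - s p) \<ge>
    2 * (int (card A) - 1) * d - 2 * (\<Sum>c\<in>A. \<bar>2 * c - X\<bar>) + \<bar>2 * p - X\<bar> + \<bar>2 * q - X\<bar>"
  using assms
proof (induction A rule: finite_ranking_induct[where f = s])
  case empty
  then show ?case by simp
next
  case (insert x S)
  consider "S = {}" | "x \<in> S" | "S \<noteq> {}" "x \<notin> S" by blast
  then show ?case
  proof cases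
    case 1
    then show ?thesis by simp
  next
    case 2
    then have "insert x S = S" by blast
    then show ?thesis using insert.IH insert.prems by simp
  next
    case 3
    have "d \<le> \<bar>a - b\<bar> + \<bar>s a - s b\<bar>" if "a \<in> S" "b \<in> S" "a \<noteq> b" for a b
      using insert.prems(2) that by simp
    from insert.IH[OF 3(1) this]
    obtain p q where pq: "p \<in> S" "q \<in> S" "2 * (s q - s p) \<ge>
      2 * (int (card S) - 1) * d - 2 * (\<Sum>c\<in>S. \<bar>2 * c - X\<bar>) + \<bar>2 * p - X\<bar> + \<bar>2 * q - X\<bar>" by blast
    \<comment> \<open>\<open>x\<close> is at least as high as all of \<open>S\<close> and becomes
      the new top end. The extra term of \<open>q\<close> then cancels: an inner point enters two
      gaps, an end point only one.\<close>
    have "x \<noteq> q" using 3(2) pq(2) by blast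
    then have "d \<le> \<bar>x - q\<bar> + \<bar>s x - s q\<bar>" using insert.prems(2) pq(2) by simp
    moreover have "\<bar>s x - s q\<bar> = s x - s q" using insert.hyps(2) pq(2) by simp
    moreover have "2 * \<bar>x - q\<bar> \<le> \<bar>2 * x - X\<bar> + \<bar>2 * q - X\<bar>" by arith
    ultimately have "2 * (s x - s q) \<ge> 2 * d - \<bar>2 * x - X\<bar> - \<bar>2 * q - X\<bar>"
      by (smt (verit))
    moreover have "(\<Sum>c\<in>insert x S. \<bar>2 * c - X\<bar>) = \<bar>2 * x - X\<bar> + (\<Sum>c\<in>S. \<bar>2 * c - X\<bar>)"
      using insert.hyps(1) 3(2) by simp
    moreover have "2 * (int (card (insert x S)) - 1) * d = 2 * (int (card S) - 1) * d + 2 * d"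
      using insert.hyps(1) 3(2) by (simp add: algebra_simps)
    ultimately have "2 * (s x - s p) \<ge> 2 * (int (card (insert x S)) - 1) * d
      - 2 * (\<Sum>c\<in>insert x S. \<bar>2 * c - X\<bar>) + \<bar>2 * p - X\<bar> + \<bar>2 * x - X\<bar>"
      using pq(3) by (smt (verit))
    then show ?thesis using pq(1) by blast
  qed
qed

text \<open>Passing from \<open>d\<close> to \<open>d + 2\<close> shifts the old summands by one
  index and adds a summand \<open>d + 1\<close> at each end.\<close>

lemma sum_abs_offsets:
  "2 * (\<Sum>i<d. \<bar>2 * int i - int d + 1\<bar>) = int d * int d - int d mod 2"
proof (induction d rule: induct_nat_012)
  case (ge2 d)
  have "(\<Sum>i<Suc (Suc d). \<bar>2 * int i - int (Suc (Suc d)) + 1\<bar>) =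
    (\<Sum>i<d. \<bar>2 * int i - int d + 1\<bar>) + 2 * (int d + 1)"
    by (subst sum.lessThan_Suc_shift) simp
  moreover have "int (Suc (Suc d)) mod 2 = int d mod 2" by presburger
  ultimately show ?case using ge2 by (simp add: algebra_simps)
qed simp_all

lemma window_offsets:
  fixes s :: "int \<Rightarrow> int" and a :: int
  assumes "1 \<le> d"
    and "\<And>b c. b \<in> {a..<a + int d} \<Longrightarrow> c \<in> {a..<a + int d} \<Longrightarrow> b \<noteq> c \<Longrightarrow>
      int d \<le> \<bar>b - c\<bar> + \<bar>s b - s c\<bar>"
  shows "\<exists>p\<in>{a..<a + int d}. \<exists>q\<in>{a..<a + int d}. 2 * (s q - s p) \<ge>
    int d * int d - 2 * int d + int d mod 2
      + \<bar>2 * p - 2 * a - int d + 1\<bar> + \<bar>2 * q - 2 * a - int d + 1\<bar>"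
proof -
  have "{a..<a + int d} \<noteq> {}" using assms(1) by simp
  from height_range_lower_bound[OF finite_atLeastLessThan_int this assms(2), of "2 * a + int d - 1"]
  obtain p q where pq: "p \<in> {a..<a + int d}" "q \<in> {a..<a + int d}"
    "2 * (s q - s p) \<ge> 2 * (int (card {a..<a + int d}) - 1) * int d
      - 2 * (\<Sum>c\<in>{a..<a + int d}. \<bar>2 * c - (2 * a + int d - 1)\<bar>)
      + \<bar>2 * p - (2 * a + int d - 1)\<bar> + \<bar>2 * q - (2 * a + int d - 1)\<bar>" by blast
  have "(\<Sum>c\<in>{a..<a + int d}. \<bar>2 * c - (2 * a + int d - 1)\<bar>) = (\<Sum>i<d. \<bar>2 * int i - int d + 1\<bar>)"
    by (rule sum.reindex_bij_witness[of _ "\<lambda>i. a + int i" "\<lambda>c. nat (c - a)"]) auto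
  then have "2 * (\<Sum>c\<in>{a..<a + int d}. \<bar>2 * c - (2 * a + int d - 1)\<bar>) = int d * int d - int d mod 2"
    by (simp only: sum_abs_offsets)
  moreover have "2 * (int (card {a..<a + int d}) - 1) * int d = 2 * (int d * int d) - 2 * int d"
    by (simp add: algebra_simps)
  moreover have "\<bar>2 * c - (2 * a + int d - 1)\<bar> = \<bar>2 * c - 2 * a - int d + 1\<bar>" for c
    by (simp add: algebra_simps)
  ultimately show ?thesis
    using pq by (intro bexI[of _ p] bexI[of _ q]) simp_all
qed

section \<open>Counting the windows close to one side\<close>

text \<open>Only the even ones among \<open>2 * t + 1\<close> consecutive integers have the form
  \<open>2 * a\<close>.\<close>

lemma card_abs_diff_double_le:
  fixes z :: int
  shows "finite {a. \<bar>z - 2 * a\<bar> \<le> int t} \<and> card {a. \<bar>z - 2 * a\<bar> \<le> int t} \<le> t + 1"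
proof -
  define I where "I = {- ((int t - z) div 2)..(z + int t) div 2}"
  have sub: "{a. \<bar>z - 2 * a\<bar> \<le> int t} \<subseteq> I" by (auto simp: I_def)
  have "card I \<le> t + 1" by (simp add: I_def)
  then show ?thesis using sub card_mono[OF _ sub] finite_subset[OF sub] by (force simp: I_def)
qed

text \<open>Row \<open>j\<close> admits at most \<open>t - 1 - 2 * j\<close> values of
  \<open>a\<close> (none if this is negative), and \<open>(t - 1) + (t - 3) + ...\<close> is at most
  \<open>t^2 / 4\<close>. The induction peels off row 0 and renumbers the others, which lowers
  \<open>t\<close> by 2.\<close>

lemma card_near_distinct_rows:
  fixes c :: "nat \<Rightarrow> int"
  assumes "\<And>a. a \<in> A \<Longrightarrow> \<exists>j. \<bar>c j - 2 * a\<bar> + 2 * int j + 2 \<le> int t"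
  shows "finite A \<and> 4 * card A \<le> t * t"
  using assms
proof (induction t arbitrary: A c rule: induct_nat_012)
  case 0
  have "A = {}" using 0 by fastforce
  then show ?case by simp
next
  case 1
  have "A = {}" using 1 by fastforce
  then show ?case by simp
next
  case (ge2 t)
  define A0 where "A0 = {a \<in> A. \<bar>c 0 - 2 * a\<bar> \<le> int t}"
  define A1 where "A1 = A - A0"
  have sub: "A0 \<subseteq> {a. \<bar>c 0 - 2 * a\<bar> \<le> int t}" by (auto simp: A0_def)
  have A0: "finite A0" "card A0 \<le> t + 1"
    using card_abs_diff_double_le[of "c 0" t] finite_subset[OF sub] card_mono[OF _ sub] by auto
  have "\<exists>j. \<bar>c (Suc j) - 2 * a\<bar> + 2 * int j + 2 \<le> int t" if a: "a \<in> A1" for a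
  proof -
    obtain j where j: "\<bar>c j - 2 * a\<bar> + 2 * int j + 2 \<le> int (Suc (Suc t))"
      using ge2.prems[of a] a unfolding A1_def by blast
    have "j \<noteq> 0" using j a by (intro notI) (simp add: A1_def A0_def)
    then obtain i where "j = Suc i" using not0_implies_Suc by blast
    then show ?thesis using j by (intro exI[of _ i]) simp
  qed
  then have A1: "finite A1" "4 * card A1 \<le> t * t" using ge2.IH(1)[of A1 "\<lambda>j. c (Suc j)"] by auto
  have A: "A = A0 \<union> A1" by (auto simp: A1_def A0_def)
  then have "card A \<le> card A0 + card A1" by (simp add: card_Un_le)
  then show ?case using A A0 A1 by (simp add: algebra_simps)
qed

section \<open>The lower bound\<close>

lemma breadth_lower_bound:
  assumes perm: "\<sigma> permutes {1..n}" and d: "4 \<le> d" "d \<le> n"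
    and breadth: "\<And>i j. i \<in> {1..n} \<Longrightarrow> j \<in> {1..n} \<Longrightarrow> i < j \<Longrightarrow>
      int d \<le> \<bar>int i - int j\<bar> + \<bar>int (\<sigma> i) - int (\<sigma> j)\<bar>"
  shows "int d * int d - 2 \<le> 2 * int n"
proof (rule ccontr)
  assume small: "\<not> ?thesis"
  define s where "s c = int (\<sigma> (nat c))" for c
  \<comment> \<open>Twice the distance of column \<open>c\<close> from the centre
    \<open>a + (d - 1) / 2\<close> of the window that starts at \<open>a\<close>.\<close>
  define D where "D a c = \<bar>2 * c - 2 * a - int d + 1\<bar>" for a c :: int
  \<comment> \<open>\<open>2 * (n - 1)\<close> less the main term of \<open>window_offsets\<close>:
    the budget shared by the doubled distances to the top and to the bottom.\<close>
  define K where "K = 2 * int n - 2 - int d * int d + 2 * int d - int d mod 2"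
  have sep: "int d \<le> \<bar>b - c\<bar> + \<bar>s b - s c\<bar>"
    if "b \<in> {1..int n}" "c \<in> {1..int n}" "b \<noteq> c" for b c
  proof (cases "b < c")
    case True
    have "int d \<le> \<bar>int (nat b) - int (nat c)\<bar> + \<bar>s b - s c\<bar>"
      unfolding s_def by (rule breadth) (use that True in auto)
    then show ?thesis using that by simp
  next
    case False
    have "int d \<le> \<bar>int (nat c) - int (nat b)\<bar> + \<bar>s c - s b\<bar>"
      unfolding s_def by (rule breadth) (use that False in auto)
    then show ?thesis using that by simp
  qed
  have range: "1 \<le> s c" "s c \<le> int n" if "c \<in> {1..int n}" for c
    using permutes_in_image[OF perm, of "nat c"] that by (auto simp: s_def)
  have window: "\<exists>p\<in>{1..int n}. \<exists>q\<in>{1..int n}.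
      (D a q + 2 * (int n - s q)) + (D a p + 2 * (s p - 1)) \<le> K"
    if "a \<in> {1..int n - int d + 1}" for a
  proof -
    have sub: "{a..<a + int d} \<subseteq> {1..int n}" using that by auto
    have "1 \<le> d" using d by simp
    then obtain p q where "p \<in> {a..<a + int d}" "q \<in> {a..<a + int d}"
      "2 * (s q - s p) \<ge> int d * int d - 2 * int d + int d mod 2 + D a p + D a q"
      using window_offsets[of d a s] sep sub unfolding D_def by blast
    moreover from this have "p \<in> {1..int n}" "q \<in> {1..int n}" using sub by blast+
    ultimately show ?thesis by (intro bexI[of _ p] bexI[of _ q]) (simp_all add: K_def)
  qed
  have "even K"
  proof -
    have "even (int d * int d + int d mod 2)" by (cases "even d") auto
    moreover have "K = 2 * (int n - 1 + int d) - (int d * int d + int d mod 2)" by (simp add: K_def)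
    ultimately show ?thesis by simp
  qed
  then obtain m where "K = 2 * m" by (elim evenE)
  define M where "M = m + 1"
  have M: "K = 2 * M - 2" using \<open>K = 2 * m\<close> by (simp add: M_def)
  have "0 \<le> K"
  proof -
    obtain p q where "p \<in> {1..int n}" "q \<in> {1..int n}"
      "(D 1 q + 2 * (int n - s q)) + (D 1 p + 2 * (s p - 1)) \<le> K"
      using window[of 1] d by auto
    then show ?thesis using range[of p] range[of q] by (simp add: D_def)
  qed
  then have M1: "1 \<le> M" using M by simp
  \<comment> \<open>The thresholds \<open>M + r\<close> and \<open>M - r\<close> have the parity of
    the doubled distances and add up to \<open>2 * M\<close>, which exceeds \<open>K\<close>. So one
    of the two distances stays below its threshold.\<close>
  define r :: int where "r = (M + int d + 1) mod 2"
  have r: "0 \<le> r" "r \<le> 1" by (auto simp: r_def)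
  have par: "even (M + r + int d + 1)" unfolding r_def by presburger
  text \<open>Since \<open>D a c\<close> has the parity of \<open>d - 1\<close>, a value exceeding \<open>M + r - 2\<close> is at least
    \<open>M + r\<close>, and similarly for \<open>M - r\<close>.\<close>
  have parity_step: "D a c + 2 * v + 2 \<le> M + r \<or> D a c + 2 * v \<ge> M + r"
    "D a c + 2 * v + 2 \<le> M - r \<or> D a c + 2 * v \<ge> M - r" for a c v
    using par unfolding D_def by presburger+
  define U where "U = {a \<in> {1..int n - int d + 1}. \<exists>q\<in>{1..int n}. D a q + 2 * (int n - s q) + 2 \<le> M + r}"
  define L where "L = {a \<in> {1..int n - int d + 1}. \<exists>p\<in>{1..int n}. D a p + 2 * (s p - 1) + 2 \<le> M - r}"
  have cover: "{1..int n - int d + 1} \<subseteq> U \<union> L"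
  proof
    fix a assume a: "a \<in> {1..int n - int d + 1}"
    obtain p q where pq: "p \<in> {1..int n}" "q \<in> {1..int n}"
      "(D a q + 2 * (int n - s q)) + (D a p + 2 * (s p - 1)) \<le> K" using window[OF a] by blast
    show "a \<in> U \<union> L"
      using parity_step(1)[of a q "int n - s q"] parity_step(2)[of a p "s p - 1"] pq a M
      unfolding U_def L_def by force
  qed
  have inv: "int (inv \<sigma> (nat (s c))) = c" if "c \<in> {1..int n}" for c
    using permutes_inverses(2)[OF perm] that by (simp add: s_def)
  \<comment> \<open>Rows are numbered downwards from the top, and \<open>inv \<sigma>\<close> finds
    the column of the point in a row. Doubling and shifting by \<open>1 - d\<close> turns the offset
    into \<open>D\<close>.\<close>
  have U: "finite U \<and> 4 * card U \<le> nat (M + r) * nat (M + r)"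
  proof (rule card_near_distinct_rows[where c = "\<lambda>j. 2 * int (inv \<sigma> (n - j)) - int d + 1"])
    fix a assume "a \<in> U"
    then obtain q where q: "q \<in> {1..int n}" "D a q + 2 * (int n - s q) + 2 \<le> M + r" by (auto simp: U_def)
    have "n - nat (int n - s q) = nat (s q)" "int (nat (int n - s q)) = int n - s q"
      using range[OF q(1)] by auto
    then show "\<exists>j. \<bar>2 * int (inv \<sigma> (n - j)) - int d + 1 - 2 * a\<bar> + 2 * int j + 2 \<le> int (nat (M + r))"
      using q inv[OF q(1)] M1 r by (intro exI[of _ "nat (int n - s q)"]) (simp add: D_def algebra_simps)
  qed
  \<comment> \<open>Here rows are numbered upwards from the bottom. \<open>M - r\<close> is
    nonnegative since \<open>M \<ge> 1\<close> and \<open>r \<le> 1\<close>, so \<open>nat\<close>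
    truncates nothing.\<close>
  have L: "finite L \<and> 4 * card L \<le> nat (M - r) * nat (M - r)"
  proof (rule card_near_distinct_rows[where c = "\<lambda>j. 2 * int (inv \<sigma> (j + 1)) - int d + 1"])
    fix a assume "a \<in> L"
    then obtain p where p: "p \<in> {1..int n}" "D a p + 2 * (s p - 1) + 2 \<le> M - r" by (auto simp: L_def)
    have "nat (s p - 1) + 1 = nat (s p)" "int (nat (s p - 1)) = s p - 1"
      using range[OF p(1)] by auto
    then show "\<exists>j. \<bar>2 * int (inv \<sigma> (j + 1)) - int d + 1 - 2 * a\<bar> + 2 * int j + 2 \<le> int (nat (M - r))"
      using p inv[OF p(1)] M1 r by (intro exI[of _ "nat (s p - 1)"]) (simp add: D_def algebra_simps)
  qed
  have "card {1..int n - int d + 1} \<le> card (U \<union> L)"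
    by (rule card_mono) (use U L cover in auto)
  also have "\<dots> \<le> card U + card L" by (rule card_Un_le)
  finally have "4 * (int n - int d + 1) \<le> 4 * int (card U) + 4 * int (card L)" using d by simp
  moreover have "4 * int (card U) \<le> (M + r) * (M + r)" "4 * int (card L) \<le> (M - r) * (M - r)"
  proof -
    have "int (4 * card U) \<le> int (nat (M + r) * nat (M + r))" using U by (simp only: of_nat_le_iff)
    then show "4 * int (card U) \<le> (M + r) * (M + r)" using M1 r by simp
    have "int (4 * card L) \<le> int (nat (M - r) * nat (M - r))" using L by (simp only: of_nat_le_iff)
    then show "4 * int (card L) \<le> (M - r) * (M - r)" using M1 r by simp
  qed
  ultimately have count: "4 * (int n - int d + 1) \<le> (M + r) * (M + r) + (M - r) * (M - r)"
    by (meson add_mono order_trans)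
  have "r = 0 \<or> r = 1" using r by linarith
  then have "(M + r) * (M + r) + (M - r) * (M - r) \<le> 2 * (M * M) + 2"
    by (auto simp: algebra_simps)
  moreover have "2 * int n = 2 * M + int d * int d - 2 * int d + int d mod 2"
    using M by (simp add: K_def)
  \<comment> \<open>Equivalently \<open>(d - 2)^2 - 2 \<le> (M - 1)^2\<close>. The assumption
    \<open>small\<close> gives \<open>M \<le> d - 2\<close>, so the right side is at most
    \<open>(d - 3)^2\<close>, which forces \<open>2 * d \<le> 7\<close>.\<close>
  ultimately have key: "int d * int d - 4 * int d + 2 * M \<le> M * M - 1"
    using count by (simp add: algebra_simps)
  have "2 * M \<le> 2 * int d - 3" using small M by (simp add: K_def)
  then have "M \<le> int d - 2" by linarith
  then have "(M - 1) * (M - 1) \<le> (int d - 3) * (int d - 3)"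
    using M1 by (intro mult_mono) auto
  then show False using key d by (simp add: algebra_simps)
qed

lemma prolific_lower_bound:
  assumes prol: "prolific k n \<sigma>"
  shows "k * k + 4 * k + 2 \<le> 2 * n"
proof -
  have k: "1 \<le> k" "k < n" and perm: "\<sigma> permutes {1..n}"
    using prol by (auto simp: prolific_def)
  have range: "1 \<le> \<sigma> i \<and> \<sigma> i \<le> n" if "1 \<le> i" "i \<le> n" for i
    using permutes_in_image[OF perm, of i] that by simp
  \<comment> \<open>Columns 1 and 2 are adjacent, and their heights differ by at most
    \<open>n - 1\<close>.\<close>
  have n: "k + 2 \<le> n"
    using prolific_breadth[OF prol, of 1 2] k range[of 1] range[of 2] by auto
  show ?thesis
  proof (cases "k = 1")
    case True
    \<comment> \<open>\<open>breadth_lower_bound\<close> asks for \<open>d \<ge> 4\<close>, so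
      \<open>d = 3\<close> is done by hand: neighbouring heights would differ by 2, giving columns 1
      and 3 the same height and distance only 2.\<close>
    have "n \<noteq> 3"
    proof
      assume "n = 3"
      then show False
        using True prolific_breadth[OF prol, of 1 2] prolific_breadth[OF prol, of 2 3]
          prolific_breadth[OF prol, of 1 3] range[of 1] range[of 2] range[of 3]
        by (simp add: abs_if split: if_splits)
    qed
    then show ?thesis using True n by simp
  next
    case False
    have "int (k + 2) * int (k + 2) - 2 \<le> 2 * int n"
    proof (rule breadth_lower_bound[OF perm])
      show "4 \<le> k + 2" "k + 2 \<le> n" using False k n by auto
      show "int (k + 2) \<le> \<bar>int i - int j\<bar> + \<bar>int (\<sigma> i) - int (\<sigma> j)\<bar>"
        if "i \<in> {1..n}" "j \<in> {1..n}" "i < j" for i j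
        using prolific_breadth[OF prol that] by simp
    qed
    then have "int (k * k + 4 * k + 2) \<le> int (2 * n)" by (simp add: algebra_simps)
    then show ?thesis by (simp only: of_nat_le_iff)
  qed
qed

theorem theorem3p4:
  fixes k :: nat
  assumes "k \<ge> 1"
  shows "minprol k \<ge> enat (nat \<lceil>(real k)\<^sup>2 / 2 + 2 * real k + 1\<rceil>) \<and>
         (\<forall>n \<sigma>. n > k \<longrightarrow> prolific k n \<sigma> \<longrightarrow>
            int n \<ge> \<lceil>(real k)\<^sup>2 / 2 + 2 * real k + 1\<rceil>)"
proof -
  have bound: "\<lceil>(real k)\<^sup>2 / 2 + 2 * real k + 1\<rceil> \<le> int n" if "prolific k n \<sigma>" for n \<sigma>
  proof -
    have "real (k * k + 4 * k + 2) \<le> real (2 * n)"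
      using prolific_lower_bound[OF that] by (simp only: of_nat_le_iff)
    then show ?thesis unfolding ceiling_le_iff power2_eq_square by simp
  qed
  then have "enat (nat \<lceil>(real k)\<^sup>2 / 2 + 2 * real k + 1\<rceil>) \<le> minprol k"
    unfolding minprol_def by (intro Inf_greatest) (auto simp: nat_le_iff)
  with bound show ?thesis by blast
qed

end
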